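(* Let $R\subset\mathbb{R}$ be a subring with $1\in R$, let $I$ be an interval with $\inf I=0$, and let $\mathscr{M}$ be a symmetric and monotone $R$-weighted mean on $I$. Let $\lambda=(\lambda_n)_{n=1}^\infty\in W^0(R)$ and $\Lambda_n:=\lambda_1+\dots+\lambda_n$. If $\Lambda_n\to\infty$ and $\lambda_n/\Lambda_n\to 0$ as $n\to\infty$, then $\mathscr{H}_{\mathscr{M}}(\mathbf{1})=\mathscr{H}_{\mathscr{M}}(\lambda)$, where $\mathbf{1}=(1,1,1,\dots)$.
   Context: $\mathbb{N}$ denotes the positive integers. Let $R\subset\mathbb{R}$ be a ring with $1\in R$, and $W_n(R):=\{(\lambda_1,\dots,\lambda_n)\in R^n : \lambda_i\ge 0,\ \lambda_1+\dots+\lambda_n>0\}$. An $R$-weighted mean on an interval $I$ is a function $\mathscr{M}\colon\bigcup_{n=1}^\infty I^n\times W_n(R)\to I$ such that: (i) $\mathscr{M}(x,\lambda)=\mathscr{M}(x,t\lambda)$ for all $(x,\lambda)\in I^n\times W_n(R)$ and $t\in R$, $t>0$ (nullhomogeneity in the weights); (ii) $\mathscr{M}(x,\lambda+\mu)=\mathscr{M}(x\odot x,\lambda\odot\mu)$ for all $x\in I^n$, $\lambda,\mu\in W_n(R)$, where $(p_1,\dots,p_n)\odot(q_1,\dots,q_n):=(p_1,q_1,\dots,p_n,q_n)$ (reduction principle); (iii) $\min_i x_i\le\mathscr{M}(x,\lambda)\le\max_i x_i$ (mean value property); (iv) entries with zero weight can be omitted, i.e. deleting $x_j$ and $\lambda_j$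 when $\lambda_j=0$ does not change the value (elimination principle). $\mathscr{M}$ is symmetric if $\mathscr{M}(x,\lambda)=\mathscr{M}(x\circ\sigma,\lambda\circ\sigma)$ for all $n$, $x\in I^n$, $\lambda\in W_n(R)$ and permutations $\sigma\in S_n$; it is monotone if it is nondecreasing in each of its entries $x_i$. $W^0(R)$ is the set of infinite sequences with all terms in $R\cap(0,+\infty)$. For $I$ with $\inf I=0$ and $\lambda\in W^0(R)$, the $\lambda$-weighted Hardy constant $\mathscr{H}_{\mathscr{M}}(\lambda)$ is the smallest extended real number $C$ such that $\sum_{n=1}^\infty\lambda_n\,\mathscr{M}\big((x_1,\dots,x_n),(\lambda_1,\dots,\lambda_n)\big)\le C\sum_{n=1}^\infty\lambda_nx_n$ for all sequences $(x_n)_{n=1}^\infty$ in $I$ (equivalently, for all those with $\sum_n\lambda_n x_n<\infty$). *)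

theory Defs
  imports "HOL-Analysis.Analysis" "HOL-Combinatorics.Permutations"
begin

definition real_subring :: "real set \<Rightarrow> bool" where
  "real_subring R \<longleftrightarrow>
     0 \<in> R \<and> 1 \<in> R \<and>
     (\<forall>a\<in>R. \<forall>b\<in>R. a + b \<in> R \<and> a * b \<in> R) \<and> (\<forall>a\<in>R. - a \<in> R)"

text \<open>Tuples of varying length are lists. An element of the domain of a mean is a pair of lists
  of a common length n; n is positive because the weights have a positive sum.\<close>

definition weight_vectors :: "real set \<Rightarrow> nat \<Rightarrow> real list set" where
  "weight_vectors R n =
     {l. length l = n \<and> set l \<subseteq> R \<and> (\<forall>a\<in>set l. 0 \<le> a) \<and> sum_list l > 0}"

definition point_vectors :: "real set \<Rightarrow> nat \<Rightarrow> real list set" where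
  "point_vectors I n = {x. length x = n \<and> set x \<subseteq> I}"

definition delete_nth :: "nat \<Rightarrow> 'a list \<Rightarrow> 'a list" where
  "delete_nth j x = take j x @ drop (Suc j) x"

text \<open>A mean is a total function on pairs of lists, constrained only on its mathematical domain.
  On lists of equal length, \<^term>\<open>splice [p1, p2] [q1, q2] = [p1, q1, p2, q2]\<close> is the
  interleaving product of the reduction principle.\<close>

definition weighted_mean ::
  "real set \<Rightarrow> real set \<Rightarrow> (real list \<Rightarrow> real list \<Rightarrow> real) \<Rightarrow> bool" where
  "weighted_mean R I M \<longleftrightarrow>
     (\<forall>n. \<forall>x \<in> point_vectors I n. \<forall>l \<in> weight_vectors R n.
        M x l \<in> I) \<and>
     (\<forall>n. \<forall>x \<in> point_vectors I n. \<forall>l \<in> weight_vectors R n. \<forall>t\<in>R. 0 < t \<longrightarrow>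
        M x l = M x (map (\<lambda>a. t * a) l)) \<and>
     (\<forall>n. \<forall>x \<in> point_vectors I n. \<forall>l \<in> weight_vectors R n. \<forall>m \<in> weight_vectors R n.
        M x (map2 (+) l m) = M (splice x x) (splice l m)) \<and>
     (\<forall>n. \<forall>x \<in> point_vectors I n. \<forall>l \<in> weight_vectors R n.
        Min (set x) \<le> M x l \<and> M x l \<le> Max (set x)) \<and>
     (\<forall>n. \<forall>x \<in> point_vectors I n. \<forall>l \<in> weight_vectors R n. \<forall>j<n. l ! j = 0 \<longrightarrow>
        M x l = M (delete_nth j x) (delete_nth j l))"

definition symmetric_mean ::
  "real set \<Rightarrow> real set \<Rightarrow> (real list \<Rightarrow> real list \<Rightarrow> real) \<Rightarrow> bool" where
  "symmetric_mean R I M \<longleftrightarrow>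
     (\<forall>n. \<forall>x \<in> point_vectors I n. \<forall>l \<in> weight_vectors R n. \<forall>\<sigma>. \<sigma> permutes {..<n} \<longrightarrow>
        M x l = M (permute_list \<sigma> x) (permute_list \<sigma> l))"

definition monotone_mean ::
  "real set \<Rightarrow> real set \<Rightarrow> (real list \<Rightarrow> real list \<Rightarrow> real) \<Rightarrow> bool" where
  "monotone_mean R I M \<longleftrightarrow>
     (\<forall>n. \<forall>x \<in> point_vectors I n. \<forall>l \<in> weight_vectors R n. \<forall>j<n. \<forall>y\<in>I. x ! j \<le> y \<longrightarrow>
        M x l \<le> M (x[j := y]) l)"

text \<open>Sequences are indexed from 0, so \<^term>\<open>w n\<close> is the (n+1)-st weight.\<close>

definition weight_sequences :: "real set \<Rightarrow> (nat \<Rightarrow> real) set" where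
  "weight_sequences R = {w. \<forall>n. w n \<in> R \<and> 0 < w n}"

definition prefix_mean ::
  "(real list \<Rightarrow> real list \<Rightarrow> real) \<Rightarrow> (nat \<Rightarrow> real) \<Rightarrow> (nat \<Rightarrow> real) \<Rightarrow> nat \<Rightarrow> real" where
  "prefix_mean M w x n = M (map x [0..<Suc n]) (map w [0..<Suc n])"

text \<open>The series are taken in the extended reals and may be infinite (all terms are nonnegative
  when the infimum of \<^term>\<open>I\<close> is 0). The infimum below is a minimum, see
  \<open>hardy_constant_bound\<close>.\<close>

definition hardy_constant ::
  "real set \<Rightarrow> (real list \<Rightarrow> real list \<Rightarrow> real) \<Rightarrow> (nat \<Rightarrow> real) \<Rightarrow> ereal" where
  "hardy_constant I M w =
     Inf {C. \<forall>x. (\<forall>n. x n \<in> I) \<longrightarrow>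
            (\<Sum>n. ereal (w n * prefix_mean M w x n)) \<le> C * (\<Sum>n. ereal (w n * x n))}"

lemma prefix_in_domain:
  assumes "w \<in> weight_sequences R" "\<And>n. x n \<in> I"
  shows "map x [0..<Suc n] \<in> point_vectors I (Suc n)"
    and "map w [0..<Suc n] \<in> weight_vectors R (Suc n)"
proof -
  show "map x [0..<Suc n] \<in> point_vectors I (Suc n)"
    using assms(2) by (auto simp: point_vectors_def)
  have "sum_list (map w [0..<Suc n]) = (\<Sum>i<Suc n. w i)"
    by (simp only: sum_list_distinct_conv_sum_set distinct_upt set_upt atLeast0LessThan)
  moreover have "(\<Sum>i<Suc n. w i) > 0"
    using assms(1) by (intro sum_pos) (auto simp: weight_sequences_def)
  ultimately show "map w [0..<Suc n] \<in> weight_vectors R (Suc n)"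
    using assms(1) by (auto simp: weight_vectors_def weight_sequences_def less_imp_le simp del: upt_Suc)
qed

lemma hardy_constant_bound:
  assumes M: "weighted_mean R I M" and w: "w \<in> weight_sequences R"
    and I: "I \<noteq> {}" "bdd_below I" "Inf I = 0" and x: "\<And>n. x n \<in> I"
  shows "(\<Sum>n. ereal (w n * prefix_mean M w x n)) \<le> hardy_constant I M w * (\<Sum>n. ereal (w n * x n))"
proof -
  let ?A = "\<lambda>x. \<Sum>n. ereal (w n * prefix_mean M w x n)"
  let ?B = "\<lambda>x. \<Sum>n. ereal (w n * x n)"
  let ?H = "hardy_constant I M w"
  have wpos: "0 < w n" for n using w by (auto simp: weight_sequences_def)
  have Ige: "0 \<le> a" if "a \<in> I" for a using cInf_lower[OF that I(2)] I(3) by simp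
  have MI: "M a l \<in> I" and Mmin: "Min (set a) \<le> M a l" and Mmax: "M a l \<le> Max (set a)"
    if "a \<in> point_vectors I n" "l \<in> weight_vectors R n" for a l n
    using M that by (simp_all add: weighted_mean_def)
  have PI: "prefix_mean M w y n \<in> I" if "\<And>n. y n \<in> I" for y n
    unfolding prefix_mean_def using prefix_in_domain[where n=n and x=y, OF w that] by (rule MI)
  have nn: "0 \<le> ereal (w n * y n)" "0 \<le> ereal (w n * prefix_mean M w y n)"
    if "\<And>n. y n \<in> I" for y n
    using Ige[OF that] Ige[OF PI, OF that] wpos[of n] by (auto simp: less_imp_le)
  have Bnn: "0 \<le> ?B y" "0 \<le> ?A y" if "\<And>n. y n \<in> I" for y
    by (intro suminf_0_le nn that)+
  have single: "f k \<le> suminf f" if "\<And>n. 0 \<le> f n" for f :: "nat \<Rightarrow> ereal" and k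
    using sum_le_suminf[OF summable_ereal_pos[OF that], of "{k}"] that by simp
  have one: "ereal (w k * y k) \<le> ?B y" if y: "\<And>n. y n \<in> I" for y k
    by (rule single[where k=k]) (rule nn(1), rule y)
  have P0: "prefix_mean M w y 0 = y 0" if "\<And>n. y n \<in> I" for y
  proof -
    have "Min (set (map y [0..<Suc 0])) \<le> prefix_mean M w y 0"
         "prefix_mean M w y 0 \<le> Max (set (map y [0..<Suc 0]))"
      unfolding prefix_mean_def using prefix_in_domain[where n=0 and x=y, OF w that]
      by (blast intro: Mmin Mmax)+
    then show ?thesis by simp
  qed
  have Aone: "ereal (w 0 * y 0) \<le> ?A y" if y: "\<And>n. y n \<in> I" for y
  proof -
    have "ereal (w 0 * prefix_mean M w y 0) \<le> ?A y"
      by (rule single[where k=0]) (rule nn(2), rule y)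
    then show ?thesis by (simp only: P0[of y, OF y])
  qed
  have low: "?A y / ?B y \<le> ?H" if y: "\<And>n. y n \<in> I" and fin: "0 < ?B y" "?B y < \<infinity>" for y
    unfolding hardy_constant_def
  proof (rule Inf_greatest, clarify)
    fix C assume "\<forall>x. (\<forall>n. x n \<in> I) \<longrightarrow> ?A x \<le> C * ?B x"
    then have "?A y \<le> C * ?B y" using y by blast
    then show "?A y / ?B y \<le> C"
      using fin by (subst ereal_divide_le_pos) (auto simp: mult.commute)
  qed
  consider "?B x = 0" | "0 < ?B x" "?B x < \<infinity>" | "?B x = \<infinity>"
    using Bnn(1)[of x, OF x] by (cases "?B x = 0"; cases "?B x = \<infinity>") (auto simp: less_le)
  then show ?thesis
  proof cases
    case 1
    have x0: "x n = 0" for n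
      using one[of x, OF x, of n] 1 wpos[of n] Ige[OF x, of n] by (auto simp: mult_le_0_iff)
    have "prefix_mean M w x n = 0" for n
    proof -
      have "Min (set (map x [0..<Suc n])) \<le> prefix_mean M w x n"
           "prefix_mean M w x n \<le> Max (set (map x [0..<Suc n]))"
        unfolding prefix_mean_def using prefix_in_domain[where n=n and x=x, OF w x]
        by (blast intro: Mmin Mmax)+
      moreover have "set (map x [0..<Suc n]) = {0}" using x0 by auto
      ultimately show ?thesis by (simp del: upt_Suc set_map set_upt)
    qed
    then show ?thesis using 1 by (simp flip: zero_ereal_def)
  next
    case 2
    then show ?thesis using low[of x, OF x 2] by (subst (asm) ereal_divide_le_pos) (auto simp: mult.commute)
  next
    case 3
    have "\<exists>k. x k \<noteq> 0"
    proof (rule ccontr)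
      assume "\<not> ?thesis"
      then have "?B x = 0" by (simp flip: zero_ereal_def)
      with 3 show False by simp
    qed
    then obtain k where k: "x k > 0" using Ige[OF x] by (metis less_le)
    have "\<exists>a\<in>I. a < (1/2)^n / w n" for n
      using cInf_lessD[OF I(1), of "(1/2)^n / w n"] I(3) wpos[of n] by auto
    then obtain a where a: "\<And>n. a n \<in> I" "\<And>n. a n < (1/2)^n / w n" by metis
    define y where "y = (\<lambda>n. if n = 0 then x k else a n)"
    have y: "y n \<in> I" for n using a x by (auto simp: y_def)
    have "summable (\<lambda>n. w n * y n)"
    proof (rule summable_comparison_test')
      show "summable (\<lambda>n. (1/2::real)^n)" by (rule summable_geometric) simp
      show "norm (w n * y n) \<le> (1/2)^n" if "n \<ge> 1" for n
        using that a(2)[of n] Ige[OF y, of n] wpos[of n] by (auto simp: y_def field_simps)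
    qed
    then have "?B y = ereal (\<Sum>n. w n * y n)"
      by (intro sums_unique[symmetric]) (simp add: sums_ereal summable_sums)
    then have fin: "?B y < \<infinity>" by simp
    have pos: "0 < ereal (w 0 * y 0)" using wpos[of 0] k by (simp add: y_def)
    have "0 < ?A y" "0 < ?B y"
      using less_le_trans[OF pos Aone[of y, OF y]] less_le_trans[OF pos one[of y, OF y, of 0]]
      by blast+
    then have "0 < ?A y / ?B y" using fin by (simp add: ereal_less_divide_pos)
    then have "0 < ?H" using low[of y, OF y \<open>0 < ?B y\<close> fin] by (rule less_le_trans)
    then show ?thesis using 3 by auto
  qed
qed

end

theory Submission
  imports Defs
begin

text \<open>The heart of the matter is a one-sided comparison: if the partial sums of the weights \<open>w\<close>
  diverge and each weight is eventually negligible against its partial sum, then the Hardy constant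
  of \<open>w\<close> is at least that of every other weight sequence \<open>v\<close> (\<open>hardy_constant_le\<close>). The
  sequence \<open>1, 1, \<dots>\<close> satisfies these conditions too, so the theorem is this comparison used twice.

  For the comparison, picture a finite sequence \<open>x\<close> with weights \<open>v\<close> as a step function on the
  half-line. Rearrange it in decreasing order, stretch it horizontally by a large factor \<open>T\<close>, and
  sample it along the blocks whose lengths are the weights \<open>w\<close> (\<open>dilated_rearrangement\<close>). As all
  relevant blocks are short compared to \<open>T\<close> (\<open>weights_eventually_small\<close>), the sampled sequence has
  weighted sum close to \<open>T\<close> times that of \<open>x\<close>, while its weighted sum of means is almost at least
  \<open>T\<close> times that of \<open>x\<close>. So the ratio attained by \<open>x\<close> under \<open>v\<close> is attained under \<open>w\<close> in the limit
  \<open>T \<rightarrow> \<infinity>\<close> (\<open>finite_hardy_inequality\<close>).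

  What makes the means comparable, although \<open>v\<close>, \<open>w\<close> and the rearrangement have nothing in common, is
  that a symmetric and monotone weighted mean respects stochastic dominance
  (\<open>prefix_mean_dominance\<close>): if for every level \<open>c\<close> the share of the weight that sits on values
  \<open>\<ge> c\<close> is at most as large for one tuple as for another, then so is the mean. This follows by
  splitting entries with the reduction principle and matching them greedily.\<close>

section \<open>Weighted tuples as multisets\<close>

text \<open>By symmetry a mean sees only the multiset of the pairs (value, weight) of its arguments, so
  pairs carry a value in the first and a weight in the second component.\<close>

definition total_weight :: "(real \<times> real) multiset \<Rightarrow> real" where
  "total_weight A = (\<Sum>q\<in>#A. snd q)"

definition weight_above :: "real \<Rightarrow> (real \<times> real) multiset \<Rightarrow> real" where
  "weight_above c A = total_weight (filter_mset (\<lambda>q. c \<le> fst q) A)"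

lemma total_weight_simps [simp]:
  "total_weight {#} = 0" "total_weight (add_mset q A) = snd q + total_weight A"
  "total_weight (A + B) = total_weight A + total_weight B"
  by (simp_all add: total_weight_def)

lemma weight_above_simps [simp]:
  "weight_above c {#} = 0"
  "weight_above c (add_mset q A) = (if c \<le> fst q then snd q else 0) + weight_above c A"
  by (simp_all add: weight_above_def)

lemma total_weight_mset: "total_weight (mset L) = sum_list (map snd L)"
  unfolding total_weight_def by (simp flip: sum_mset_sum_list)

locale monotone_symmetric_mean =
  fixes R I :: "real set" and M :: "real list \<Rightarrow> real list \<Rightarrow> real"
  assumes ring: "real_subring R"
    and mean: "weighted_mean R I M"
    and symmetric: "symmetric_mean R I M"
    and monotone: "monotone_mean R I M"
begin

definition admissible :: "(real \<times> real) multiset \<Rightarrow> bool" where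
  "admissible A \<longleftrightarrow> (\<forall>q\<in>#A. fst q \<in> I \<and> snd q \<in> R \<and> 0 \<le> snd q)"

lemma admissible_simps [simp]:
  "admissible {#}"
  "admissible (add_mset q A) \<longleftrightarrow> fst q \<in> I \<and> snd q \<in> R \<and> 0 \<le> snd q \<and> admissible A"
  "admissible (A + B) \<longleftrightarrow> admissible A \<and> admissible B"
  by (auto simp: admissible_def)

lemma ring_simps:
  "0 \<in> R" "1 \<in> R" "a \<in> R \<Longrightarrow> b \<in> R \<Longrightarrow> a + b \<in> R"
  "a \<in> R \<Longrightarrow> b \<in> R \<Longrightarrow> a * b \<in> R"
  using ring by (auto simp: real_subring_def)

lemma ring_diff: "a \<in> R \<Longrightarrow> b \<in> R \<Longrightarrow> a - b \<in> R"
  using ring unfolding real_subring_def by (metis diff_conv_add_uminus)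

lemma total_weight_admissible:
  assumes "admissible A" shows "total_weight A \<in> R" "0 \<le> total_weight A"
  using assms by (induction A) (auto simp: ring_simps)

lemma domain_iff:
  "admissible (mset L) \<and> 0 < total_weight (mset L) \<longleftrightarrow>
   map fst L \<in> point_vectors I (length L) \<and> map snd L \<in> weight_vectors R (length L)"
  by (auto simp: admissible_def point_vectors_def weight_vectors_def total_weight_mset)

text \<open>On admissible multisets of positive total weight the value is independent of the chosen
  enumeration by symmetry. This turns permutation invariance into plain equality of multisets.\<close>

definition multiset_mean :: "(real \<times> real) multiset \<Rightarrow> real" where
  "multiset_mean A = (let L = (SOME L. mset L = A) in M (map fst L) (map snd L))"

lemma multiset_mean_mset:
  assumes "admissible (mset L)" "0 < total_weight (mset L)"
  shows "multiset_mean (mset L) = M (map fst L) (map snd L)"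
proof -
  define K where "K = (SOME K. mset K = mset L)"
  have K: "mset K = mset L" unfolding K_def by (rule someI[of _ L]) simp
  then obtain \<sigma> where \<sigma>: "\<sigma> permutes {..<length L}" "permute_list \<sigma> L = K"
    by (rule mset_eq_permutation)
  have "M (map fst L) (map snd L) =
      M (permute_list \<sigma> (map fst L)) (permute_list \<sigma> (map snd L))"
    using symmetric \<sigma>(1) assms domain_iff[of L] unfolding symmetric_mean_def by blast
  also have "\<dots> = M (map fst K) (map snd K)"
    using \<sigma> by (simp add: permute_list_map)
  finally show ?thesis by (simp add: multiset_mean_def K_def Let_def)
qed

lemma multiset_mean_zero:
  assumes "admissible A" "0 < total_weight A" "a \<in> I"
  shows "multiset_mean (add_mset (a, 0) A) = multiset_mean A"
proof -
  obtain L where L: "A = mset L" by (metis ex_mset)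
  let ?L = "(a, 0) # L"
  have d: "admissible (mset ?L)" "0 < total_weight (mset ?L)" using assms L by (auto simp: ring_simps)
  then have "M (map fst ?L) (map snd ?L) = M (delete_nth 0 (map fst ?L)) (delete_nth 0 (map snd ?L))"
    using mean domain_iff[of ?L] unfolding weighted_mean_def by fastforce
  then show ?thesis
    using multiset_mean_mset[OF d] multiset_mean_mset[of L] assms L by (simp add: delete_nth_def)
qed

lemma multiset_mean_zeros:
  assumes "admissible A" "0 < total_weight A" "set xs \<subseteq> I"
  shows "multiset_mean (mset (map (\<lambda>x. (x, 0)) xs) + A) = multiset_mean A"
  using assms(3)
proof (induction xs)
  case (Cons x xs)
  have "admissible (mset (map (\<lambda>x. (x, 0)) xs)) \<and> total_weight (mset (map (\<lambda>x. (x, 0)) xs)) = 0"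
    using Cons.prems by (induction xs) (auto simp: ring_simps)
  with Cons assms show ?case by (simp add: multiset_mean_zero)
qed simp

lemma mset_splice: "mset (splice xs ys) = mset xs + mset ys"
  by (induction xs ys rule: splice.induct) auto

lemma zip_splice:
  "length xs = length ls \<Longrightarrow> length ys = length ms \<Longrightarrow>
   zip (splice xs ys) (splice ls ms) = splice (zip xs ls) (zip ys ms)"
proof (induction xs ys arbitrary: ls ms rule: splice.induct)
  case (2 x xs ys)
  then show ?case by (cases ls) auto
qed auto

text \<open>This is the usable core of the reduction principle: split the weight vector
  $(p + q, l_1, \dots, l_n)$ as $(p, l_1, \dots, l_n) + (q, 0, \dots, 0)$ and eliminate the zeros.
  Both summands need a positive sum to be weight vectors, which is why the cases $p = 0$ and
  $q = 0$ are treated apart, by elimination.\<close>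

lemma multiset_mean_merge:
  assumes "admissible A" "a \<in> I" "p \<in> R" "q \<in> R" "0 \<le> p" "0 \<le> q" "0 < p + q + total_weight A"
  shows "multiset_mean (add_mset (a, p) (add_mset (a, q) A)) = multiset_mean (add_mset (a, p + q) A)"
proof -
  consider "p = 0" | "q = 0" | "0 < p" "0 < q" using assms by linarith
  then show ?thesis
  proof cases
    case 1
    then show ?thesis using assms by (simp add: multiset_mean_zero)
  next
    case 2
    then show ?thesis using assms by (subst add_mset_commute) (simp add: multiset_mean_zero)
  next
    case 3
    obtain L where L: "A = mset L" by (metis ex_mset)
    define n where "n = Suc (length L)"
    let ?x = "a # map fst L" and ?l = "p # map snd L" and ?m = "q # map (\<lambda>_. 0) L"
    have Lw: "admissible (mset L)" "0 \<le> total_weight (mset L)" using assms L total_weight_admissible by auto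
    have z: "sum_list (map (\<lambda>_. 0) L) = (0::real)" by (induction L) auto
    have x: "?x \<in> point_vectors I n"
      using assms L by (auto simp: point_vectors_def n_def admissible_def)
    have l: "?l \<in> weight_vectors R n"
      using assms 3 L Lw by (auto simp: weight_vectors_def n_def admissible_def total_weight_mset)
    have m: "?m \<in> weight_vectors R n"
      using assms 3 z by (auto simp: weight_vectors_def n_def ring_simps)
    have eq: "map2 (+) ?l ?m = (p + q) # map snd L"
      by (simp add: zip_map_map map2_map_map) (simp add: zip_same_conv_map)
    let ?S = "splice (zip ?x ?l) (zip ?x ?m)"
    have zS: "zip (splice ?x ?x) (splice ?l ?m) = ?S" by (rule zip_splice) simp_all
    have S: "map fst ?S = splice ?x ?x" "map snd ?S = splice ?l ?m"
      unfolding zS[symmetric] by (simp_all del: splice.simps)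
    have mS: "mset ?S = mset (map (\<lambda>x. (x, 0)) (map fst L)) + add_mset (a, p) (add_mset (a, q) A)"
    proof -
      have "zip (map fst L) (map snd L) = L" by (rule zip_map_fst_snd)
      moreover have "zip (map fst L) (map (\<lambda>_. 0::real) L) = map (\<lambda>x. (x, 0)) (map fst L)"
        by (simp add: zip_map_map zip_same_conv_map)
      ultimately show ?thesis unfolding mset_splice by (simp add: L)
    qed
    have I: "set (map fst L) \<subseteq> I" using Lw by (auto simp: admissible_def)
    have w0: "admissible (mset (map (\<lambda>x. (x, 0)) (map fst L)))"
      "total_weight (mset (map (\<lambda>x. (x, 0)) (map fst L))) = 0"
      using I z by (auto simp: admissible_def ring_simps total_weight_mset o_def simp del: mset_map)
    have "multiset_mean (add_mset (a, p + q) A) = M ?x ((p + q) # map snd L)"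
      using multiset_mean_mset[of "(a, p + q) # L"] assms 3 L Lw by (simp add: ring_simps)
    also have "\<dots> = M (splice ?x ?x) (splice ?l ?m)"
      using mean x l m unfolding weighted_mean_def eq[symmetric] by blast
    also have "\<dots> = multiset_mean (mset ?S)"
    proof -
      have "admissible (mset ?S)" "0 < total_weight (mset ?S)"
        unfolding mS using w0 assms 3 L Lw by simp_all
      then show ?thesis using multiset_mean_mset[of ?S] unfolding S by simp
    qed
    also have "\<dots> = multiset_mean (add_mset (a, p) (add_mset (a, q) A))"
      unfolding mS using assms 3 L Lw I by (intro multiset_mean_zeros) auto
    finally show ?thesis by simp
  qed
qed

lemma multiset_mean_mono:
  assumes "admissible A" "a \<in> I" "b \<in> I" "a \<le> b" "p \<in> R" "0 \<le> p" "0 < p + total_weight A"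
  shows "multiset_mean (add_mset (a, p) A) \<le> multiset_mean (add_mset (b, p) A)"
proof -
  obtain L where L: "A = mset L" by (metis ex_mset)
  let ?L = "(a, p) # L"
  have d: "admissible (mset ?L)" "0 < total_weight (mset ?L)"
    "admissible (mset ((b, p) # L))" "0 < total_weight (mset ((b, p) # L))"
    using assms L by auto
  have "M (map fst ?L) (map snd ?L) \<le> M ((map fst ?L)[0 := b]) (map snd ?L)"
    using monotone d(1,2) domain_iff[of ?L] assms unfolding monotone_mean_def by fastforce
  then show ?thesis using multiset_mean_mset[OF d(1,2)] multiset_mean_mset[OF d(3,4)] L by simp
qed

lemma multiset_mean_scale:
  assumes "admissible A" "0 < total_weight A" "t \<in> R" "0 < t"
  shows "multiset_mean (image_mset (\<lambda>q. (fst q, t * snd q)) A) = multiset_mean A"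
proof -
  obtain L where L: "A = mset L" by (metis ex_mset)
  let ?L = "map (\<lambda>q. (fst q, t * snd q)) L"
  have "admissible (mset ?L)" using assms L by (auto simp: admissible_def ring_simps)
  moreover have "0 < total_weight (mset ?L)"
    using assms L by (simp add: total_weight_mset o_def sum_list_const_mult del: mset_map)
  ultimately have "multiset_mean (mset ?L) = M (map fst ?L) (map snd ?L)" by (rule multiset_mean_mset)
  also have "\<dots> = M (map fst L) (map (\<lambda>a. t * a) (map snd L))" by (simp add: o_def)
  also have "\<dots> = M (map fst L) (map snd L)"
    using mean domain_iff[of L] assms L unfolding weighted_mean_def by metis
  finally show ?thesis using multiset_mean_mset[of L] assms L by simp
qed

lemma weight_above_nonneg: "admissible A \<Longrightarrow> 0 \<le> weight_above c A"
  by (induction A) auto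

lemma weight_above_zero: "(\<And>q. q \<in># A \<Longrightarrow> fst q < c) \<Longrightarrow> weight_above c A = 0"
  by (induction A) (force simp: not_le)+

lemma weight_above_pos: "0 < weight_above c A \<Longrightarrow> \<exists>q\<in>#A. c \<le> fst q \<and> 0 < snd q"
  by (induction A) (auto split: if_splits, smt (verit))

section \<open>Stochastic dominance\<close>

text \<open>The proof transports weight greedily from \<^term>\<open>A\<close> to \<^term>\<open>B\<close>. Let \<open>(a, p)\<close> be an entry of
  \<^term>\<open>A\<close> with the largest value. By dominance at level \<open>a\<close>, some entry \<open>(b, q)\<close> of \<^term>\<open>B\<close> has
  positive weight and \<open>a \<le> b\<close>. Cut the amount \<open>min p q\<close> from both entries with the merging rule,
  raise \<open>a\<close> to \<open>b\<close> on that portion by monotonicity, and move it into the common part \<^term>\<open>K\<close>.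
  The remainders still satisfy dominance: at levels up to \<open>a\<close> both sides lose the same amount, and
  above \<open>a\<close> nothing is left of \<^term>\<open>A\<close>. At least one of the two entries disappears, so the
  total number of entries drops. Since \<^term>\<open>R\<close> is a ring, all weights that arise stay in it.
  Entries of weight 0 are discarded beforehand by elimination.\<close>

lemma multiset_mean_dominance_equal_weight:
  assumes "admissible A" "admissible B" "admissible K" "total_weight A = total_weight B"
    and "0 < total_weight K + total_weight A"
    and "\<And>c. weight_above c A \<le> weight_above c B"
  shows "multiset_mean (K + A) \<le> multiset_mean (K + B)"
  using assms
proof (induction "size A + size B" arbitrary: A B K rule: less_induct)
  case less
  note prems = less.prems
  show ?case
  proof (cases "A = {#}")
    case True
    show ?thesis
    proof (cases "B = {#}")
      case False
      then obtain b q B' where B: "B = add_mset (b, q) B'"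
        by (metis multiset_nonemptyE surj_pair multi_member_split)
      have "q = 0" "total_weight B' = 0" using prems B True total_weight_admissible(2)[of B'] by auto
      then have "multiset_mean (K + B) = multiset_mean (K + B')"
        using B prems True by (simp add: multiset_mean_zero)
      moreover have "multiset_mean (K + A) \<le> multiset_mean (K + B')"
        using prems B True \<open>total_weight B' = 0\<close> by (intro less.hyps) (auto simp: weight_above_nonneg)
      ultimately show ?thesis by simp
    qed (simp add: True)
  next
    case False
    define a where "a = Max (fst ` set_mset A)"
    have "a \<in> fst ` set_mset A" unfolding a_def using False by (intro Max_in) auto
    then obtain p A' where A: "A = add_mset (a, p) A'"
      by (metis (no_types, lifting) imageE multi_member_split prod.collapse)
    have amax: "fst s \<le> a" if "s \<in># A" for s unfolding a_def using that by (intro Max_ge) auto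
    have wA: "admissible A'" "a \<in> I" "p \<in> R" "0 \<le> p" using prems A by auto
    show ?thesis
    proof (cases "p = 0")
      case True
      have "multiset_mean (K + A) = multiset_mean (K + A')"
        using A True prems wA by (simp add: multiset_mean_zero)
      moreover have "multiset_mean (K + A') \<le> multiset_mean (K + B)"
      proof (rule less.hyps)
        show "weight_above c A' \<le> weight_above c B" for c using prems(6)[of c] A True by (simp split: if_splits)
      qed (use prems A True in simp_all)
      ultimately show ?thesis by simp
    next
      case False
      have "0 < weight_above a A" using A False wA weight_above_nonneg[of A' a] by auto
      then have "0 < weight_above a B" using prems(6) less_le_trans by blast
      then obtain b q B' where B: "B = add_mset (b, q) B'" and b: "a \<le> b" "0 < q"
        by (metis weight_above_pos multi_member_split prod.collapse)
      have wB: "admissible B'" "b \<in> I" "q \<in> R" using prems B by auto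
      have tA': "0 \<le> total_weight A'" "0 \<le> total_weight B'" "0 \<le> total_weight K"
        using total_weight_admissible wA wB prems by auto
      have high: "weight_above c A' = 0" if "a < c" for c
        by (rule weight_above_zero) (use amax A that in force)
      have nnB: "0 \<le> weight_above c B'" for c using wB weight_above_nonneg by auto
      have up: "(if c \<le> a then p else 0) + weight_above c A' \<le> (if c \<le> b then q else 0) + weight_above c B'" for c
        using prems(6)[of c] unfolding A B by (simp only: weight_above_simps fst_conv snd_conv)
      define r where "r = min p q"
      have r: "r \<in> R" "0 < r" "p - r \<in> R" "q - r \<in> R" "0 \<le> p - r" "0 \<le> q - r"
        using wA wB b False by (auto simp: r_def min_def ring_simps ring_diff)
      \<comment> \<open>What remains of \<^term>\<open>A\<close> and \<^term>\<open>B\<close>. The exhausted entry is dropped, not kept with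
        weight 0, so that the induction measure decreases.\<close>
      define A1 where "A1 = (if p \<le> q then A' else add_mset (a, p - r) A')"
      define B1 where "B1 = (if p \<le> q then add_mset (b, q - r) B' else B')"
      have mA: "multiset_mean (K + A) = multiset_mean (add_mset (a, r) K + A1)"
        using multiset_mean_merge[of "K + A'" a r "p - r"] A r wA prems tA'
        by (auto simp: A1_def r_def)
      have mB: "multiset_mean (add_mset (b, r) K + B1) = multiset_mean (K + B)"
        using multiset_mean_merge[of "K + B'" b r "q - r"] B r wB prems tA'
        by (auto simp: B1_def r_def)
      have wA1: "admissible A1" using wA r by (auto simp: A1_def)
      have wB1: "admissible B1" using wB r by (auto simp: B1_def)
      have t1: "total_weight A1 = total_weight A - r" "total_weight B1 = total_weight B - r"
        using A B by (auto simp: A1_def B1_def r_def)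
      have "multiset_mean (add_mset (a, r) K + A1) \<le> multiset_mean (add_mset (b, r) K + A1)"
        using wA1 prems t1 r wA wB b tA' by (simp add: multiset_mean_mono)
      also have "\<dots> \<le> multiset_mean (add_mset (b, r) K + B1)"
      proof (rule less.hyps)
        show "size A1 + size B1 < size A + size B" by (auto simp: A B A1_def B1_def)
        show "admissible A1" "admissible B1" by fact+
        show "admissible (add_mset (b, r) K)" using prems wB r by simp
        show "total_weight A1 = total_weight B1" using t1 prems by simp
        show "0 < total_weight (add_mset (b, r) K) + total_weight A1" using prems t1 by simp
        show "weight_above c A1 \<le> weight_above c B1" for c
          using up[of c] high[of c] nnB[of c] b(1) r
          by (cases "c \<le> a") (auto simp: A1_def B1_def r_def)
      qed
      finally show ?thesis using mA mB by simp
    qed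
  qed
qed

text \<open>Nullhomogeneity reduces different totals to equal ones: each side is scaled by the total of
  the other, which is a factor in \<^term>\<open>R\<close>.\<close>

lemma multiset_mean_dominance:
  assumes A: "admissible A" "0 < total_weight A" and B: "admissible B" "0 < total_weight B"
    and le: "\<And>c. weight_above c A * total_weight B \<le> weight_above c B * total_weight A"
  shows "multiset_mean A \<le> multiset_mean B"
proof -
  define s where "s t = image_mset (\<lambda>q::real\<times>real. (fst q, t * snd q))" for t :: real
  have tot: "total_weight (s t C) = t * total_weight C" for t C
    by (induction C) (auto simp: s_def algebra_simps)
  have upp: "weight_above c (s t C) = t * weight_above c C" for t c C
    by (induction C) (auto simp: s_def algebra_simps)
  have w: "admissible (s t C)" if "admissible C" "t \<in> R" "0 < t" for t C
    using that by (auto simp: admissible_def s_def ring_simps)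
  have R: "total_weight A \<in> R" "total_weight B \<in> R" using A B total_weight_admissible by auto
  have "multiset_mean A = multiset_mean (s (total_weight B) A)" using A B R by (simp add: s_def multiset_mean_scale)
  also have "\<dots> \<le> multiset_mean (s (total_weight A) B)"
    using multiset_mean_dominance_equal_weight[of "s (total_weight B) A" "s (total_weight A) B" "{#}"] A B R w le
    by (simp add: tot upp mult.commute)
  also have "\<dots> = multiset_mean B" using A B R by (simp add: s_def multiset_mean_scale)
  finally show ?thesis .
qed

lemma prefix_mean_in:
  assumes "u \<in> weight_sequences R" "\<And>k. y k \<in> I"
  shows "prefix_mean M u y n \<in> I"
proof -
  have "M a l \<in> I" if "a \<in> point_vectors I k" "l \<in> weight_vectors R k" for a l k
    using mean that by (simp add: weighted_mean_def)
  from this[OF prefix_in_domain[OF assms]] show ?thesis by (simp add: prefix_mean_def)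
qed

lemma prefix_mean_0:
  assumes "u \<in> weight_sequences R" "\<And>k. y k \<in> I"
  shows "prefix_mean M u y 0 = y 0"
proof -
  have "Min (set a) \<le> M a l \<and> M a l \<le> Max (set a)"
    if "a \<in> point_vectors I k" "l \<in> weight_vectors R k" for a l k
    using mean that by (simp add: weighted_mean_def)
  from this[OF prefix_in_domain[where x=y and n=0, OF assms]] show ?thesis by (simp add: prefix_mean_def)
qed

lemma prefix_mean_dominance:
  assumes v: "v \<in> weight_sequences R" and w: "w \<in> weight_sequences R"
    and x: "\<And>n. x n \<in> I" and z: "\<And>n. z n \<in> I"
    and le: "\<And>c. (\<Sum>k | k \<le> j \<and> c \<le> x k. v k) * (\<Sum>k\<le>n. w k)
      \<le> (\<Sum>k | k \<le> n \<and> c \<le> z k. w k) * (\<Sum>k\<le>j. v k)"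
  shows "prefix_mean M v x j \<le> prefix_mean M w z n"
proof -
  define P where "P u y i = mset (map (\<lambda>k. (y k, u k)) [0..<Suc i])" for u y :: "nat \<Rightarrow> real" and i
  have P: "P u y i = image_mset (\<lambda>k. (y k, u k)) (mset_set {..i})" for u y i
    unfolding P_def mset_map mset_upt by (simp add: atLeast0LessThan lessThan_Suc_atMost)
  have tot: "total_weight (P u y i) = (\<Sum>k\<le>i. u k)" for u y i
    by (simp add: P total_weight_def image_mset.compositionality o_def sum_unfold_sum_mset)
  have upp: "weight_above c (P u y i) = (\<Sum>k | k \<le> i \<and> c \<le> y k. u k)" for c u y i
    by (simp add: P weight_above_def total_weight_def image_mset.compositionality o_def sum_unfold_sum_mset
        filter_mset_image_mset)
  have wt: "admissible (P u y i)" and pos: "0 < total_weight (P u y i)"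
    and pm: "prefix_mean M u y i = multiset_mean (P u y i)"
    if u: "u \<in> weight_sequences R" and y: "\<And>k. y k \<in> I" for u y i
  proof -
    have "admissible (P u y i) \<and> 0 < total_weight (P u y i)"
      using prefix_in_domain[OF u, of y I i, OF y]
        domain_iff[of "map (\<lambda>k. (y k, u k)) [0..<Suc i]"]
      unfolding P_def by (simp del: upt_Suc add: o_def)
    then show "admissible (P u y i)" "0 < total_weight (P u y i)" by auto
    then show "prefix_mean M u y i = multiset_mean (P u y i)"
      unfolding P_def by (subst multiset_mean_mset) (simp_all del: upt_Suc add: o_def prefix_mean_def)
  qed
  show ?thesis
    unfolding pm[OF v x] pm[OF w z]
    by (rule multiset_mean_dominance) (use wt[OF v x] wt[OF w z] pos[OF v x] pos[OF w z] le in \<open>auto simp: tot upp\<close>)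
qed

end

section \<open>Partial sums of slowly varying weights\<close>

text \<open>On the scale of a large dilation factor \<^term>\<open>T\<close>, each weight whose block starts in
  $[0, T U]$ is negligible: late weights because they are small against their partial sum, which is
  itself at most of order \<open>T U\<close>, and the finitely many early ones because \<^term>\<open>T\<close> is large.\<close>

lemma weights_eventually_small:
  fixes w :: "nat \<Rightarrow> real"
  assumes pos: "\<And>n. 0 < w n" and lim: "(\<lambda>n. w n / (\<Sum>i\<le>n. w i)) \<longlonglongrightarrow> 0"
    and \<delta>: "0 < \<delta>" and U: "0 \<le> U"
  obtains T where "1 \<le> T" "\<And>m. (\<Sum>i<m. w i) \<le> T * U \<Longrightarrow> w m \<le> \<delta> * T"
proof -
  define \<eta> where "\<eta> = min (1/2) (\<delta> / (2 * (U + 1)))"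
  have \<eta>: "0 < \<eta>" using \<delta> U by (simp add: \<eta>_def)
  have \<eta>_le: "\<eta> \<le> 1/2" "\<eta> \<le> \<delta> / (2 * (U + 1))"
    unfolding \<eta>_def by (rule min.cobounded1, rule min.cobounded2)
  obtain n0 where n0: "\<And>n. n \<ge> n0 \<Longrightarrow> w n / (\<Sum>i\<le>n. w i) < \<eta>"
    using order_tendstoD(2)[OF lim \<eta>] by (auto simp: eventually_sequentially)
  define T where "T = 1 + (\<Sum>i<n0. w i) / \<delta>"
  have "0 \<le> (\<Sum>i<n0. w i)" using pos by (intro sum_nonneg less_imp_le)
  then have T: "1 \<le> T" "(\<Sum>i<n0. w i) \<le> \<delta> * T"
    using \<delta> by (auto simp: T_def field_simps)
  show ?thesis
  proof (rule that[OF T(1)])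
    fix m assume m: "(\<Sum>i<m. w i) \<le> T * U"
    show "w m \<le> \<delta> * T"
    proof (cases "m < n0")
      case True
      have "w m \<le> (\<Sum>i<n0. w i)" using True pos by (intro member_le_sum) (auto intro: less_imp_le)
      with T(2) show ?thesis by simp
    next
      case False
      have W: "(\<Sum>i\<le>m. w i) = (\<Sum>i<m. w i) + w m" by (simp flip: lessThan_Suc_atMost)
      have "0 < (\<Sum>i\<le>m. w i)" using pos by (intro sum_pos) auto
      then have "w m \<le> \<eta> * (\<Sum>i<m. w i) + \<eta> * w m"
        using n0[of m] False by (simp add: W field_simps)
      moreover have "\<eta> * w m \<le> w m / 2" using \<eta>_le(1) pos[of m] by (simp add: field_simps)
      moreover have "\<eta> * (\<Sum>i<m. w i) \<le> \<delta> / (2 * (U + 1)) * (T * U)"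
        using \<eta> \<eta>_le(2) m U \<delta> pos by (intro mult_mono sum_nonneg) (auto intro: less_imp_le)
      moreover have "\<delta> / (2 * (U + 1)) * (T * U) \<le> \<delta> * T / 2"
        using U \<delta> T(1) by (simp add: field_simps)
      ultimately show ?thesis by linarith
    qed
  qed
qed

text \<open>The blocks \<open>[W r, W (r + 1))\<close> between successive partial sums of the weights tile the
  half-line; \<open>r \<tau>\<close> is the index of the block that contains \<open>\<tau>\<close>.\<close>

lemma partial_sum_crossing:
  fixes w :: "nat \<Rightarrow> real"
  assumes pos: "\<And>n. 0 < w n" and div: "filterlim (\<lambda>n. \<Sum>i\<le>n. w i) at_top sequentially"
  obtains r where "\<And>\<tau>. 0 \<le> \<tau> \<Longrightarrow> (\<Sum>i<r \<tau>. w i) \<le> \<tau>" "\<And>\<tau>. \<tau> < (\<Sum>i<Suc (r \<tau>). w i)"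
    "mono r"
proof -
  have ex: "\<exists>m. \<tau> < (\<Sum>i<Suc m. w i)" for \<tau>
    using filterlim_at_top_dense[THEN iffD1, OF div, rule_format, of \<tau>]
    by (auto simp: eventually_sequentially lessThan_Suc_atMost)
  define r where "r \<tau> = (LEAST m. \<tau> < (\<Sum>i<Suc m. w i))" for \<tau>
  show ?thesis
  proof (rule that[of r])
    show gt: "\<tau> < (\<Sum>i<Suc (r \<tau>). w i)" for \<tau> unfolding r_def by (rule LeastI_ex) (rule ex)
    show "mono r"
    proof (rule monoI)
      fix \<sigma> \<tau> :: real assume "\<sigma> \<le> \<tau>"
      then have "\<sigma> < (\<Sum>i<Suc (r \<tau>). w i)" using gt[of \<tau>] by simp
      then show "r \<sigma> \<le> r \<tau>" unfolding r_def[of \<sigma>] by (rule Least_le)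
    qed
    show "(\<Sum>i<r \<tau>. w i) \<le> \<tau>" if "0 \<le> \<tau>" for \<tau>
    proof (cases "r \<tau>")
      case (Suc m)
      then have "m < r \<tau>" by simp
      then have "\<not> \<tau> < (\<Sum>i<Suc m. w i)" unfolding r_def by (rule not_less_Least)
      then show ?thesis using Suc by simp
    qed (use that in simp)
  qed
qed

lemma decreasing_enumeration:
  fixes x :: "nat \<Rightarrow> real"
  obtains \<pi> where "bij_betw \<pi> {..<N} {..<N}" "\<And>i j. i \<le> j \<Longrightarrow> j < N \<Longrightarrow> x (\<pi> j) \<le> x (\<pi> i)"
proof -
  define L where "L = sort_key (\<lambda>i. - x i) [0..<N]"
  have L: "distinct L" "length L = N" "set L = {..<N}" by (auto simp: L_def)
  have s: "sorted (map (\<lambda>i. - x i) L)" unfolding L_def by (rule sorted_sort_key)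
  show ?thesis
  proof (rule that[of "\<lambda>i. L ! i"])
    show "bij_betw ((!) L) {..<N} {..<N}" by (rule bij_betw_nth) (use L in auto)
    show "x (L ! j) \<le> x (L ! i)" if "i \<le> j" "j < N" for i j
      using sorted_nth_mono[OF s that(1)] that L by simp
  qed
qed

section \<open>Transplanting a finite sequence to other weights\<close>

text \<open>Let \<open>f\<close> be the nonincreasing rearrangement on the half-line of the step function that
  takes the value \<open>x i\<close> on a set of length \<open>v i\<close>, for \<open>i < N\<close>, stretched horizontally by the
  factor \<open>T\<close>. The sequence \<open>z\<close> samples \<open>f\<close> at the left end of each block of \<^term>\<open>w\<close>, with the larger
  of the two values if \<open>f\<close> jumps there, and follows \<^term>\<open>a\<close> once the support of \<open>f\<close> is exhausted.
  Sampling on the left overestimates \<open>f\<close>, so every level set of \<open>z\<close> has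
  at least the weight of the corresponding level set of \<open>f\<close>; the last conclusion says this for
  each prefix. The price is paid in the weighted sum of \<open>z\<close>, but each jump of \<open>f\<close> lies in a
  block of length at most \<open>d\<close>, so each value of \<open>x\<close> is charged at most \<open>d\<close> in excess.\<close>

lemma dilated_rearrangement:
  fixes v w x a :: "nat \<Rightarrow> real"
  assumes w: "\<And>n. 0 < w n" and v: "\<And>n. 0 < v n" and x: "\<And>n. 0 \<le> x n"
    and div: "filterlim (\<lambda>n. \<Sum>i\<le>n. w i) at_top sequentially"
    and T: "0 < T" and d: "0 \<le> d"
    and small: "\<And>m. (\<Sum>i<m. w i) \<le> T * (\<Sum>i<N. v i) \<Longrightarrow> w m \<le> d"
  obtains z K where
    "\<And>n. n < K \<Longrightarrow> \<exists>i<N. z n = x i" "\<And>n. K \<le> n \<Longrightarrow> z n = a n"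
    "(\<Sum>n<K. w n * z n) \<le> (\<Sum>i<N. x i * (T * v i + d))"
    "\<And>c n. min (\<Sum>k<n. w k) (T * (\<Sum>k | k < N \<and> c \<le> x k. v k)) \<le> (\<Sum>k | k < n \<and> c \<le> z k. w k)"
proof -
  obtain \<pi> where \<pi>: "bij_betw \<pi> {..<N} {..<N}"
    "\<And>i j. i \<le> j \<Longrightarrow> j < N \<Longrightarrow> x (\<pi> j) \<le> x (\<pi> i)"
    using decreasing_enumeration[of N x] by blast
  obtain r where r: "\<And>\<tau>. 0 \<le> \<tau> \<Longrightarrow> (\<Sum>i<r \<tau>. w i) \<le> \<tau>" "\<And>\<tau>. \<tau> < (\<Sum>i<Suc (r \<tau>). w i)"
    "mono r"
    using partial_sum_crossing[OF w div] by blast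
  define S where "S m = (\<Sum>i<m. w i)" for m
  \<comment> \<open>In decreasing order the step function jumps at the points \<open>\<tau> i\<close>; the value \<open>y i\<close> is used for
    the indices from \<open>m i\<close> up to \<open>m (i + 1)\<close>.\<close>
  define y where "y i = x (\<pi> i)" for i
  define u where "u i = v (\<pi> i)" for i
  define \<tau> where "\<tau> i = T * (\<Sum>k<i. u k)" for i
  define m where "m i = (if i = 0 then 0 else Suc (r (\<tau> i)))" for i
  have reindex: "(\<Sum>i<N. f (\<pi> i)) = (\<Sum>i<N. f i)" for f :: "nat \<Rightarrow> real"
    by (rule sum.reindex_bij_betw[OF \<pi>(1)])
  have u: "0 < u i" for i using v by (simp add: u_def)
  have \<tau>_mono: "\<tau> i \<le> \<tau> j" if "i \<le> j" for i j
    unfolding \<tau>_def using that T u by (intro mult_left_mono sum_mono2) (auto intro: less_imp_le)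
  have \<tau>_nonneg: "0 \<le> \<tau> i" for i using \<tau>_mono[of 0 i] by (simp add: \<tau>_def)
  have \<tau>N: "\<tau> N = T * (\<Sum>i<N. v i)" using reindex[of v] by (simp add: \<tau>_def u_def)
  have m_mono: "m i \<le> m j" if "i \<le> j" for i j
    using that monoD[OF r(3) \<tau>_mono[OF that]] by (auto simp: m_def)
  have m_lower: "\<tau> i \<le> S (m i)" for i
    using r(2)[of "\<tau> i"] by (auto simp: m_def S_def \<tau>_def)
  have m_upper: "S (m i) \<le> \<tau> i + d" if "i \<le> N" for i
  proof (cases "i = 0")
    case False
    have "(\<Sum>k<r (\<tau> i). w k) \<le> \<tau> i" using r(1) \<tau>_nonneg by blast
    moreover from this have "w (r (\<tau> i)) \<le> d"
      using \<tau>_mono[OF that] \<tau>N by (intro small) simp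
    ultimately show ?thesis using False by (simp add: m_def S_def)
  qed (use d in \<open>simp add: m_def S_def \<tau>_def\<close>)
  \<comment> \<open>Several jumps may fall into one block, so that \<open>m i = m (i + 1)\<close> for some \<open>i\<close>. Taking the
    least index then selects the largest value and skips the intermediate ones.\<close>
  define b where "b n = (LEAST i. n < m (Suc i))" for n
  have b_less: "b n < P" if "n < m P" for n P
  proof -
    obtain p where p: "P = Suc p" using \<open>n < m P\<close> by (cases P) (auto simp: m_def)
    then have "b n \<le> p" unfolding b_def using that by (intro Least_le) simp
    then show ?thesis using p by simp
  qed
  have b_eq: "b n = i" if "m i \<le> n" "n < m (Suc i)" for n i
  proof (rule antisym)
    show "b n \<le> i" using b_less[OF that(2)] by simp
    have "n < m (Suc (b n))" unfolding b_def by (rule LeastI) (rule that(2))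
    then have "\<not> m (Suc (b n)) \<le> m i" using that(1) by simp
    then show "i \<le> b n" using m_mono by (metis not_less_eq_eq)
  qed
  define z where "z n = (if n < m N then y (b n) else a n)" for n
  have z_block: "z n = y i" if "i < N" "m i \<le> n" "n < m (Suc i)" for i n
    using b_eq[OF that(2,3)] m_mono[of "Suc i" N] that by (simp add: z_def)
  show ?thesis
  proof (rule that[of "m N" z])
    show "\<exists>i<N. z n = x i" if "n < m N" for n
      using b_less[OF that] that bij_betw_apply[OF \<pi>(1), of "b n"] by (auto simp: z_def y_def)
    show "z n = a n" if "m N \<le> n" for n using that by (simp add: z_def)
    have "(\<Sum>n<m i. w n * z n) \<le> (\<Sum>k<i. y k * (T * u k + d))" if "i \<le> N" for i
      using that
    proof (induction i)
      case (Suc i)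
      have "(\<Sum>n<m (Suc i). w n * z n) = (\<Sum>n<m i. w n * z n) + (\<Sum>n=m i..<m (Suc i). w n * z n)"
        using m_mono[of i "Suc i"] by (simp add: lessThan_atLeast0 sum.atLeastLessThan_concat)
      moreover have "(\<Sum>n=m i..<m (Suc i). w n * z n) = (\<Sum>n=m i..<m (Suc i). w n) * y i"
        unfolding sum_distrib_right using z_block[of i] Suc.prems by (intro sum.cong) auto
      moreover have "(\<Sum>n=m i..<m (Suc i). w n) = S (m (Suc i)) - S (m i)"
        using m_mono[of i "Suc i"] sum.atLeastLessThan_concat[of 0 "m i" "m (Suc i)" w]
        by (simp add: S_def lessThan_atLeast0)
      moreover have "(S (m (Suc i)) - S (m i)) * y i \<le> (T * u i + d) * y i"
        using m_upper[OF Suc.prems] m_lower[of i] x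
        by (intro mult_right_mono) (auto simp: y_def \<tau>_def algebra_simps)
      ultimately show ?case using Suc by (simp add: mult.commute)
    qed (simp add: m_def)
    from this[of N] show "(\<Sum>n<m N. w n * z n) \<le> (\<Sum>i<N. x i * (T * v i + d))"
      using reindex[of "\<lambda>i. x i * (T * v i + d)"] by (simp add: y_def u_def)
    fix c n
    \<comment> \<open>The decreasing order makes every level set of \<open>y\<close> an initial segment.\<close>
    define P where "P = (LEAST i. N \<le> i \<or> y i < c)"
    have P: "N \<le> P \<or> y P < c" unfolding P_def by (rule LeastI[of _ N]) simp
    have PN: "P \<le> N" unfolding P_def by (rule Least_le) simp
    have below: "c \<le> y i" if "i < P" for i
      using not_less_Least[OF that[unfolded P_def]] by simp
    have level: "{i \<in> {..<N}. c \<le> y i} = {..<P}"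
    proof (rule set_eqI)
      fix i
      have "i < P" if "i < N" "c \<le> y i"
      proof (rule ccontr)
        assume "\<not> i < P"
        then have "y i \<le> y P" "P < N" using \<pi>(2)[of P i] that by (auto simp: y_def)
        then show False using P that by simp
      qed
      then show "i \<in> {i \<in> {..<N}. c \<le> y i} \<longleftrightarrow> i \<in> {..<P}" using below[of i] PN by auto
    qed
    have "{k. k < N \<and> c \<le> x k} = {k \<in> {..<N}. c \<le> x k}" by auto
    then have "(\<Sum>k | k < N \<and> c \<le> x k. v k) = (\<Sum>k<N. if c \<le> x k then v k else 0)"
      by (simp only: sum.inter_filter finite_lessThan)
    also have "\<dots> = (\<Sum>k<N. if c \<le> y k then u k else 0)"
      unfolding y_def u_def by (rule reindex[symmetric])
    also have "\<dots> = (\<Sum>k<P. u k)" by (simp only: level flip: sum.inter_filter[OF finite_lessThan])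
    finally have D: "T * (\<Sum>k | k < N \<and> c \<le> x k. v k) = \<tau> P" by (simp add: \<tau>_def)
    have "c \<le> z k" if "k < m P" for k
      using below[OF b_less[OF that]] that m_mono[OF PN] by (simp add: z_def)
    then have "S (min n (m P)) \<le> (\<Sum>k | k < n \<and> c \<le> z k. w k)"
      unfolding S_def using w by (intro sum_mono2) (auto intro: less_imp_le)
    moreover have "min (S n) (\<tau> P) \<le> S (min n (m P))"
      using m_lower[of P] by (auto simp: min_def)
    ultimately show "min (\<Sum>k<n. w k) (T * (\<Sum>k | k < N \<and> c \<le> x k. v k))
        \<le> (\<Sum>k | k < n \<and> c \<le> z k. w k)"
      unfolding D S_def[symmetric] by simp
  qed
qed

context monotone_symmetric_mean
begin

section \<open>Comparison of Hardy constants\<close>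

text \<open>Test the inequality for \<^term>\<open>w\<close> on the transplanted sequence \<open>z\<close> with \<open>d = \<delta> T\<close>. Its weighted
  sum is at most \<open>T\<close> times that of \<^term>\<open>x\<close>, up to an error of order \<open>\<delta> T\<close>. Conversely, if the
  block of index \<open>n\<close> ends in \<open>(T V\<^sub>j, T V\<^sub>j\<^sub>+\<^sub>1]\<close>, where \<open>V\<^sub>j\<close> are the partial sums of \<^term>\<open>v\<close>, the
  first \<open>n + 1\<close> entries of \<open>z\<close> dominate the first \<open>j + 1\<close> entries of \<^term>\<open>x\<close>, so the \<open>n\<close>-th mean of
  \<open>z\<close> is at least the \<open>j\<close>-th mean of \<^term>\<open>x\<close>; and the blocks of this kind have total length at least
  \<open>T v\<^sub>j - \<delta> T\<close>. Dividing by \<open>T\<close> and letting \<open>\<delta>\<close> tend to 0 gives the claim. The same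
  \<open>z\<close>, built from all of \<open>x\<^sub>0, \<dots>, x\<^sub>N\<^sub>-\<^sub>1\<close>, serves every \<open>j\<close>, because the level sets of a prefix of \<^term>\<open>x\<close>
  are contained in those of the whole.\<close>

lemma finite_hardy_inequality:
  fixes v w x :: "nat \<Rightarrow> real"
  assumes v: "v \<in> weight_sequences R" and w: "w \<in> weight_sequences R"
    and div: "filterlim (\<lambda>n. \<Sum>i\<le>n. w i) at_top sequentially"
    and lim: "(\<lambda>n. w n / (\<Sum>i\<le>n. w i)) \<longlonglongrightarrow> 0"
    and nonneg: "\<And>a. a \<in> I \<Longrightarrow> 0 \<le> a" and inf: "\<And>e. 0 < e \<Longrightarrow> \<exists>a\<in>I. a < e"
    and x: "\<And>n. x n \<in> I" and C: "0 \<le> C"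
    and hardy: "\<And>z. (\<And>n. z n \<in> I) \<Longrightarrow>
      (\<Sum>n. ereal (w n * prefix_mean M w z n)) \<le> ereal C * (\<Sum>n. ereal (w n * z n))"
  shows "(\<Sum>j<N. v j * prefix_mean M v x j) \<le> C * (\<Sum>j<N. v j * x j)"
proof -
  define X where "X j = prefix_mean M v x j" for j
  have vpos: "0 < v n" and wpos: "0 < w n" for n using v w by (auto simp: weight_sequences_def)
  have x0: "0 \<le> x n" for n by (intro nonneg x)
  have X0: "0 \<le> X j" for j unfolding X_def using v x by (intro nonneg prefix_mean_in)
  define U where "U = (\<Sum>i<N. v i)"
  define S where "S m = (\<Sum>i<m. w i)" for m
  define V where "V j = (\<Sum>i<j. v i)" for j
  have U0: "0 \<le> U" unfolding U_def using vpos by (intro sum_nonneg) (auto intro: less_imp_le)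
  have S_mono: "S i \<le> S j" if "i \<le> j" for i j
    unfolding S_def using that wpos by (intro sum_mono2) (auto intro: less_imp_le)
  have V_mono: "V i \<le> V j" if "i \<le> j" for i j
    unfolding V_def using that vpos by (intro sum_mono2) (auto intro: less_imp_le)
  obtain r where r: "\<And>\<tau>. 0 \<le> \<tau> \<Longrightarrow> S (r \<tau>) \<le> \<tau>" "\<And>\<tau>. \<tau> < S (Suc (r \<tau>))" "mono r"
    unfolding S_def using partial_sum_crossing[OF wpos div] by blast
  have main: "(\<Sum>j<N. v j * X j)
      \<le> C * (\<Sum>j<N. v j * x j) + \<delta> * ((\<Sum>j<N. X j) + C * (\<Sum>j<N. x j) + C)"
    if \<delta>: "0 < \<delta>" for \<delta>
  proof -
    obtain T where T: "1 \<le> T" and small: "\<And>m. S m \<le> T * U \<Longrightarrow> w m \<le> \<delta> * T"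
      unfolding S_def using weights_eventually_small[OF wpos lim \<delta> U0] by blast
    \<comment> \<open>As 0 may lie outside the interval, the test sequence continues with a tail of total weighted
      sum at most \<open>\<delta>\<close>.\<close>
    have "\<exists>a\<in>I. a < \<delta> * (1/2) ^ Suc n / w n" for n using inf \<delta> wpos by simp
    then obtain a where a: "\<And>n. a n \<in> I" "\<And>n. a n < \<delta> * (1/2) ^ Suc n / w n" by metis
    obtain z K where zx: "\<And>n. n < K \<Longrightarrow> \<exists>i<N. z n = x i" and za: "\<And>n. K \<le> n \<Longrightarrow> z n = a n"
      and mass: "(\<Sum>n<K. w n * z n) \<le> (\<Sum>i<N. x i * (T * v i + \<delta> * T))"
      and level: "\<And>c n. min (S n) (T * (\<Sum>k | k < N \<and> c \<le> x k. v k))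
          \<le> (\<Sum>k | k < n \<and> c \<le> z k. w k)"
    proof (rule dilated_rearrangement[where w=w and v=v and x=x and a=a and T=T and d="\<delta> * T" and N=N,
          OF wpos vpos x0 div])
      show "w m \<le> \<delta> * T" if "(\<Sum>i<m. w i) \<le> T * (\<Sum>i<N. v i)" for m
        using small that by (simp add: S_def U_def)
    qed (use T \<delta> in \<open>auto simp: S_def\<close>)
    have z: "z n \<in> I" for n using zx[of n] za[of n] a x by (cases "n < K") auto
    have Z0: "0 \<le> prefix_mean M w z n" for n using w z by (intro nonneg prefix_mean_in)

    have dominates: "X j \<le> prefix_mean M w z n" if j: "j < N" and n: "S (Suc n) \<le> T * V (Suc j)" for j n
      unfolding X_def
    proof (rule prefix_mean_dominance[OF v w x z])
      fix c
      let ?D = "\<Sum>k | k \<le> j \<and> c \<le> x k. v k"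
      let ?E = "\<Sum>k | k \<le> n \<and> c \<le> z k. w k"
      have "?D \<le> V (Suc j)"
        unfolding V_def using vpos by (intro sum_mono2) (auto intro: less_imp_le)
      moreover have "?D \<le> (\<Sum>k | k < N \<and> c \<le> x k. v k)"
        using vpos j by (intro sum_mono2) (auto intro: less_imp_le)
      moreover have "0 \<le> ?D" using vpos by (intro sum_nonneg) (auto intro: less_imp_le)
      ultimately have D: "?D \<le> V (Suc j)" "?D \<le> (\<Sum>k | k < N \<and> c \<le> x k. v k)" "0 \<le> ?D"
        by blast+
      have V0: "0 \<le> V (Suc j)" using V_mono[of 0 "Suc j"] by (simp add: V_def)
      have S0: "0 \<le> S (Suc n)" using S_mono[of 0 "Suc n"] by (simp add: S_def)
      have "T * ?D \<le> T * (\<Sum>k | k < N \<and> c \<le> x k. v k)" using D(2) T by simp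
      then have E: "min (S (Suc n)) (T * ?D) \<le> ?E" using level[of "Suc n" c] by (simp add: less_Suc_eq_le)
      \<comment> \<open>Either all sampled values reach the level \<open>c\<close>, or their weight is at least \<open>T\<close> times that of
        \<^term>\<open>x\<close>, which suffices because the totals compare as \<open>S (n + 1) \<le> T V\<^sub>j\<^sub>+\<^sub>1\<close>.\<close>
      have "?D * S (Suc n) \<le> ?E * V (Suc j)"
      proof (cases "S (Suc n) \<le> T * ?D")
        case True
        then have "S (Suc n) \<le> ?E" using E by simp
        then have "V (Suc j) * S (Suc n) \<le> V (Suc j) * ?E" using V0 by (rule mult_left_mono)
        moreover have "?D * S (Suc n) \<le> V (Suc j) * S (Suc n)" using D(1) S0 by (rule mult_right_mono)
        ultimately show ?thesis by (simp add: mult.commute)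
      next
        case False
        then have "T * ?D \<le> ?E" using E by simp
        then have "T * ?D * V (Suc j) \<le> ?E * V (Suc j)" using V0 by (rule mult_right_mono)
        moreover have "?D * S (Suc n) \<le> ?D * (T * V (Suc j))" using n D(3) by (rule mult_left_mono)
        ultimately show ?thesis by (simp add: mult_ac)
      qed
      then show "?D * (\<Sum>k\<le>n. w k) \<le> ?E * (\<Sum>k\<le>j. v k)"
        by (simp only: S_def V_def lessThan_Suc_atMost)
    qed

    have lower: "(\<Sum>j<i. X j * (T * v j - \<delta> * T)) \<le> (\<Sum>n<r (T * V i). w n * prefix_mean M w z n)"
      if "i \<le> N" for i
      using that
    proof (induction i)
      case 0
      then show ?case using wpos Z0 by (auto intro!: sum_nonneg mult_nonneg_nonneg intro: less_imp_le)
    next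
      case (Suc i)
      have V0: "0 \<le> T * V k" for k using V_mono[of 0 k] T by (simp add: V_def)
      let ?a = "r (T * V i)" and ?b = "r (T * V (Suc i))"
      have ab: "?a \<le> ?b" using V_mono[of i "Suc i"] T by (intro monoD[OF r(3)]) simp
      have b: "S ?b \<le> T * V (Suc i)" using r(1) V0 by blast
      moreover have "T * V (Suc i) \<le> T * U"
        using V_mono[OF Suc.prems] T by (simp add: U_def V_def)
      ultimately have "w ?b \<le> \<delta> * T" by (intro small) simp
      then have "T * V (Suc i) - \<delta> * T \<le> S ?b" using r(2)[of "T * V (Suc i)"] by (simp add: S_def)
      moreover have "S ?a \<le> T * V i" using r(1) V0 by blast
      ultimately have len: "T * v i - \<delta> * T \<le> S ?b - S ?a" by (simp add: V_def algebra_simps)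
      have "S ?b - S ?a = (\<Sum>n=?a..<?b. w n)"
        using ab sum.atLeastLessThan_concat[of 0 ?a ?b w] by (simp add: S_def lessThan_atLeast0)
      with len have "X i * (T * v i - \<delta> * T) \<le> X i * (\<Sum>n=?a..<?b. w n)"
        using X0 by (intro mult_left_mono) auto
      also have "\<dots> = (\<Sum>n=?a..<?b. w n * X i)" by (simp add: sum_distrib_left mult.commute)
      also have "\<dots> \<le> (\<Sum>n=?a..<?b. w n * prefix_mean M w z n)"
      proof (rule sum_mono)
        fix n assume "n \<in> {?a..<?b}"
        then have "S (Suc n) \<le> T * V (Suc i)" using S_mono[of "Suc n" ?b] b by simp
        then show "w n * X i \<le> w n * prefix_mean M w z n"
          using dominates[of i n] Suc.prems wpos[of n] by (simp add: mult_left_mono)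
      qed
      finally show ?case
        using Suc ab by (simp add: lessThan_atLeast0 flip: sum.atLeastLessThan_concat[of 0 ?a ?b])
    qed

    define g where "g n = (if n \<in> {..<K} then w n * z n else 0) + \<delta> * (1/2) ^ Suc n" for n
    have g: "g sums ((\<Sum>n<K. w n * z n) + \<delta> * 1)"
      unfolding g_def by (intro sums_add sums_If_finite_set sums_mult power_half_series) simp
    have wz0: "0 \<le> w n * z n" for n using wpos[of n] nonneg[OF z[of n]] by simp
    have wz: "w n * z n \<le> g n" for n
      using za[of n] a(2)[of n] wpos[of n] \<delta> by (cases "n < K") (auto simp: g_def field_simps)
    have sm: "summable (\<lambda>n. w n * z n)"
      by (rule summable_comparison_test'[of g 0]) (use g wz wz0 in \<open>auto simp: sums_iff\<close>)
    have upper: "(\<Sum>n. w n * z n) \<le> (\<Sum>n<K. w n * z n) + \<delta>"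
      using suminf_le[OF wz sm sums_summable[OF g]] sums_unique[OF g] by simp
    let ?r = "r (T * V N)"
    have "ereal (\<Sum>n<?r. w n * prefix_mean M w z n) = (\<Sum>n<?r. ereal (w n * prefix_mean M w z n))"
      by simp
    also have "\<dots> \<le> (\<Sum>n. ereal (w n * prefix_mean M w z n))"
      using mult_nonneg_nonneg[OF less_imp_le[OF wpos] Z0]
      by (intro sum_le_suminf summable_ereal_pos) auto
    also have "\<dots> \<le> ereal C * (\<Sum>n. ereal (w n * z n))" by (rule hardy) (rule z)
    also have "(\<Sum>n. ereal (w n * z n)) = ereal (\<Sum>n. w n * z n)"
      by (intro sums_unique[symmetric]) (simp add: sums_ereal summable_sums sm)
    finally have "(\<Sum>n<?r. w n * prefix_mean M w z n) \<le> C * (\<Sum>n. w n * z n)" by simp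
    also have "\<dots> \<le> C * ((\<Sum>i<N. x i * (T * v i + \<delta> * T)) + \<delta> * T)"
    proof (rule mult_left_mono[OF _ C])
      have "\<delta> \<le> \<delta> * T" using T \<delta> by simp
      then show "(\<Sum>n. w n * z n) \<le> (\<Sum>i<N. x i * (T * v i + \<delta> * T)) + \<delta> * T"
        using upper mass by linarith
    qed
    finally have "(\<Sum>j<N. X j * (T * v j - \<delta> * T)) \<le> C * ((\<Sum>i<N. x i * (T * v i + \<delta> * T)) + \<delta> * T)"
      using lower[of N] by simp
    moreover have "(\<Sum>j<N. X j * (T * v j - \<delta> * T)) = T * ((\<Sum>j<N. v j * X j) - \<delta> * (\<Sum>j<N. X j))"
      by (simp add: sum_distrib_left algebra_simps sum_subtractf)
    moreover have "C * ((\<Sum>i<N. x i * (T * v i + \<delta> * T)) + \<delta> * T)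
        = T * (C * (\<Sum>j<N. v j * x j) + \<delta> * (C * (\<Sum>j<N. x j) + C))"
      by (simp add: sum_distrib_left algebra_simps sum.distrib)
    ultimately have "(\<Sum>j<N. v j * X j) - \<delta> * (\<Sum>j<N. X j)
        \<le> C * (\<Sum>j<N. v j * x j) + \<delta> * (C * (\<Sum>j<N. x j) + C)"
      using T by simp
    then show ?thesis by (simp add: algebra_simps)
  qed
  define Q where "Q = (\<Sum>j<N. X j) + C * (\<Sum>j<N. x j) + C"
  have Q: "0 \<le> Q" unfolding Q_def using X0 C nonneg[OF x] by (intro add_nonneg_nonneg mult_nonneg_nonneg sum_nonneg) auto
  have "(\<Sum>j<N. v j * X j) \<le> C * (\<Sum>j<N. v j * x j)"
  proof (rule field_le_epsilon)
    fix e :: real assume e: "0 < e"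
    have "e / (Q + 1) * Q \<le> e" using e Q by (simp add: field_simps)
    then show "(\<Sum>j<N. v j * X j) \<le> C * (\<Sum>j<N. v j * x j) + e"
      using main[of "e / (Q + 1)"] e Q unfolding Q_def[symmetric] by simp
  qed
  then show ?thesis by (simp add: X_def)
qed

text \<open>A finite Hardy constant of \<^term>\<open>w\<close> enters the finite inequality as a nonnegative real. It is
  positive by testing with a constant sequence, unless \<^term>\<open>I\<close> is $\{0\}$; in that case the constant
  is \<open>- \<infinity>\<close> for all weights, because both series vanish.\<close>

lemma hardy_constant_le:
  assumes v: "v \<in> weight_sequences R" and w: "w \<in> weight_sequences R"
    and div: "filterlim (\<lambda>n. \<Sum>i\<le>n. w i) at_top sequentially"
    and lim: "(\<lambda>n. w n / (\<Sum>i\<le>n. w i)) \<longlonglongrightarrow> 0"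
    and I: "I \<noteq> {}" "bdd_below I" "Inf I = 0"
  shows "hardy_constant I M v \<le> hardy_constant I M w"
proof -
  have nonneg: "0 \<le> a" if "a \<in> I" for a using cInf_lower[OF that I(2)] I(3) by simp
  have inf: "\<exists>a\<in>I. a < e" if "0 < e" for e using cInf_lessD[OF I(1)] I(3) that by simp
  have pos: "0 < u n" if "u \<in> weight_sequences R" for u n using that by (auto simp: weight_sequences_def)
  have terms: "0 \<le> u n * y n" "0 \<le> u n * prefix_mean M u y n"
    if "u \<in> weight_sequences R" "\<And>k. y k \<in> I" for u y n
    using pos[OF that(1), of n] nonneg[OF that(2)[of n]] nonneg[OF prefix_mean_in[OF that]]
    by (simp_all)
  have bound: "(\<Sum>n. ereal (w n * prefix_mean M w z n)) \<le> hardy_constant I M w * (\<Sum>n. ereal (w n * z n))"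
    if "\<And>n. z n \<in> I" for z by (rule hardy_constant_bound[OF mean w I that])
  show ?thesis
  proof (cases "I = {0}")
    case True
    have "prefix_mean M u y n = 0" if "u \<in> weight_sequences R" "\<And>k. y k \<in> I" for u y n
      using prefix_mean_in[OF that] True by simp
    then show ?thesis using v w True unfolding hardy_constant_def by (simp add: zero_ereal_def[symmetric])
  next
    case False
    then obtain a where a: "a \<in> I" "0 < a" using nonneg I(1) by (metis less_le singletonI subsetI subset_singletonD)
    have "prefix_mean M w (\<lambda>_. a) 0 = a" using prefix_mean_0[OF w, of "\<lambda>_. a"] a by simp
    then have "0 < ereal (w 0 * prefix_mean M w (\<lambda>_. a) 0)" using pos[OF w] a by simp
    also have "\<dots> \<le> (\<Sum>n. ereal (w n * prefix_mean M w (\<lambda>_. a) n))"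
      using sum_le_suminf[OF summable_ereal_pos, of "\<lambda>n. ereal (w n * prefix_mean M w (\<lambda>_. a) n)" "{0}"]
        terms(2)[OF w, of "\<lambda>_. a"] a by simp
    also have "\<dots> \<le> hardy_constant I M w * (\<Sum>n. ereal (w n * a))" using bound[of "\<lambda>_. a"] a by simp
    finally have prod: "0 < hardy_constant I M w * (\<Sum>n. ereal (w n * a))" .
    have "0 \<le> (\<Sum>n. ereal (w n * a))" using terms(1)[OF w, of "\<lambda>_. a"] a by (intro suminf_0_le) auto
    then have H: "0 < hardy_constant I M w" using prod by (auto simp: ereal_zero_less_0_iff)
    show ?thesis
    proof (cases "hardy_constant I M w")
      case (real C)
      have C: "0 \<le> C" using H real by simp
      show ?thesis
        unfolding hardy_constant_def[of I M v]
      proof (intro Inf_lower CollectI allI impI)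
        fix x :: "nat \<Rightarrow> real" assume "\<forall>n. x n \<in> I"
        then have x: "x n \<in> I" for n by simp
        show "(\<Sum>n. ereal (v n * prefix_mean M v x n)) \<le> hardy_constant I M w * (\<Sum>n. ereal (v n * x n))"
        proof (rule suminf_bound, intro allI)
          fix N
          have "(\<Sum>n<N. v n * prefix_mean M v x n) \<le> C * (\<Sum>n<N. v n * x n)"
            using bound unfolding real
            by (intro finite_hardy_inequality[OF v w div lim nonneg inf x C]) auto
          then have "(\<Sum>n<N. ereal (v n * prefix_mean M v x n)) \<le> ereal C * (\<Sum>n<N. ereal (v n * x n))"
            by simp
          also have "\<dots> \<le> ereal C * (\<Sum>n. ereal (v n * x n))"
            using C terms(1)[OF v x]
            by (intro ereal_mult_left_mono sum_le_suminf summable_ereal_pos) auto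
          finally show "(\<Sum>n<N. ereal (v n * prefix_mean M v x n)) \<le> hardy_constant I M w * (\<Sum>n. ereal (v n * x n))"
            using real by simp
        qed (use terms(2)[OF v x] in auto)
      qed
    qed (use H in auto)
  qed
qed

end

text \<open>The constant weights 1 have partial sums \<open>n + 1\<close> and so diverge slowly as well, which allows
  the comparison in both directions.\<close>

theorem theorem3p2:
  fixes R I :: "real set"
    and M :: "real list \<Rightarrow> real list \<Rightarrow> real"
    and w :: "nat \<Rightarrow> real"
  assumes "real_subring R"
    and "is_interval I" "I \<noteq> {}" "bdd_below I" "Inf I = 0"
    and "weighted_mean R I M" "symmetric_mean R I M" "monotone_mean R I M"
    and "w \<in> weight_sequences R"
    and "filterlim (\<lambda>n. \<Sum>i\<le>n. w i) at_top sequentially"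
    and "(\<lambda>n. w n / (\<Sum>i\<le>n. w i)) \<longlonglongrightarrow> 0"
  shows "hardy_constant I M (\<lambda>_. 1) = hardy_constant I M w"
proof -
  interpret monotone_symmetric_mean R I M
    by unfold_locales fact+
  have one: "(\<lambda>_. 1) \<in> weight_sequences R" by (simp add: weight_sequences_def ring_simps)
  have sum: "(\<Sum>i\<le>n. 1) = real (Suc n)" for n by simp
  have div: "filterlim (\<lambda>n. \<Sum>i\<le>n. 1 :: real) at_top sequentially"
    unfolding sum by (rule filterlim_compose[OF filterlim_real_sequentially filterlim_Suc])
  have lim: "(\<lambda>n. 1 / (\<Sum>i\<le>n. 1 :: real)) \<longlonglongrightarrow> 0"
    unfolding sum using LIMSEQ_inverse_real_of_nat by (simp add: inverse_eq_divide)
  show ?thesis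
    using hardy_constant_le[OF one assms(9,10,11,3,4,5)]
      hardy_constant_le[OF assms(9) one div lim assms(3,4,5)] by (rule antisym)
qed

end
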